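(* Let $\alpha\in\mathbb R\setminus\{0,1\}$ and let $\mathscr G_j=\{G_j: D^s_\alpha(G_j,F_j)\le\epsilon_j\}$, $j\in\{0,1\}$, be the symmetric $\alpha$-divergence neighborhoods. The least favorable densities for these classes, i.e. the maximizing densities (for given $u\in(0,1)$) in the problem (P) stated in the context, are determined by the system of coupled nonlinear equations $$\frac{\lambda_0}{1-\alpha}\left(\frac{\hat g_0}{f_0}\right)^{2\alpha-1}+\left((1-u)\left(\frac{\hat g_1}{\hat g_0}\right)^{u}-\frac{\lambda_0}{\alpha(1-\alpha)}-\mu_0\right)\left(\frac{\hat g_0}{f_0}\right)^{\alpha}+\frac{\lambda_0}{\alpha}=0,$$ $$\frac{\lambda_1}{1-\alpha}\left(\frac{\hat g_1}{f_1}\right)^{2\alpha-1}+\left(u\left(\frac{\hat g_1}{\hat g_0}\right)^{u-1}-\frac{\lambda_1}{\alpha(1-\alpha)}-\mu_1\right)\left(\frac{\hat g_1}{f_1}\right)^{\alpha}+\frac{\lambda_1}{\alpha}=0.$$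
   Context: $F_0,F_1$ are the nominal probability distributions on $\Omega$ under $\mathcal H_0,\mathcal H_1$, with densities $f_0,f_1$ with respect to a dominating measure $\mu$; $g_j$ is the density of $G_j$; $\epsilon_0,\epsilon_1$ are the robustness parameters. The symmetrized $\alpha$-divergence is $$D^s_\alpha(G_j,F_j)=\frac1{\alpha(1-\alpha)}\int_\Omega\left(f_j^{\alpha}-g_j^{\alpha}\right)\left(f_j^{1-\alpha}-g_j^{1-\alpha}\right)d\mu.$$ The $u$-affinity is $D_u(G_0,G_1)=\int_\Omega g_1^{\,u}g_0^{\,1-u}\,d\mu$. Write $\Upsilon(G)=\int_\Omega g\,d\mu$. Problem (P): find $\hat g_0,\hat g_1$ and $\hat u$ such that $$\hat g_0=\arg\sup_{G_0\in\mathscr G_0}D_u(G_0,G_1)\ \text{ s.t. } g_0>0,\ \Upsilon(G_0)=1,\qquad \hat g_1=\arg\sup_{G_1\in\mathscr G_1}D_u(G_0,G_1)\ \text{ s.t. } g_1>0,\ \Upsilon(G_1)=1,$$ $$\hat u=\arg\min_{u\in(0,1)}D_u(\hat G_0,\hat G_1).$$ The two maximizations are coupled (in each of them the other argument is the other least favorable distribution) and are performed for the given $u$; the minimization over $u$ is then performed. The scalars $\lambda_j,\mu_j$ are the Lagrangian (KKT) multipliers in $$L_j=D_u(G_0,G_1)+\lambda_j\bigl(\epsilon_j-D^s_\alpha(G_j,F_j)\bigr)+\mu_j\bigl(1-\Upsilon(G_j)\bigr),\quad j\in\{0,1\}.$$ *)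

theory Defs
  imports "HOL-Analysis.Analysis"
begin

text \<open>
  \<open>M\<close> is the dominating measure on the sample space; a distribution is represented by its
  density with respect to \<open>M\<close>, a real function considered up to \<open>M\<close>-null sets.
\<close>

definition u_affinity :: "'a measure \<Rightarrow> real \<Rightarrow> ('a \<Rightarrow> real) \<Rightarrow> ('a \<Rightarrow> real) \<Rightarrow> real" where
  "u_affinity M u g0 g1 = (\<integral>x. g1 x powr u * g0 x powr (1 - u) \<partial>M)"

definition total_mass :: "'a measure \<Rightarrow> ('a \<Rightarrow> real) \<Rightarrow> real" where
  "total_mass M g = (\<integral>x. g x \<partial>M)"

definition sym_alpha_integrand :: "real \<Rightarrow> ('a \<Rightarrow> real) \<Rightarrow> ('a \<Rightarrow> real) \<Rightarrow> 'a \<Rightarrow> real" where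
  "sym_alpha_integrand \<alpha> g f x =
     (f x powr \<alpha> - g x powr \<alpha>) * (f x powr (1 - \<alpha>) - g x powr (1 - \<alpha>))"

definition sym_alpha_div :: "'a measure \<Rightarrow> real \<Rightarrow> ('a \<Rightarrow> real) \<Rightarrow> ('a \<Rightarrow> real) \<Rightarrow> real" where
  "sym_alpha_div M \<alpha> g f = 1 / (\<alpha> * (1 - \<alpha>)) * (\<integral>x. sym_alpha_integrand \<alpha> g f x \<partial>M)"

text \<open>
  For positive \<open>f\<close>, \<open>g\<close> the integrand divided by \<open>\<alpha> * (1 - \<alpha>)\<close> is nonnegative, so integrability
  says exactly that the divergence is finite. It has to be required explicitly because the
  integral of a non-integrable function is \<open>0\<close> by convention.
  Likewise \<open>0 powr a = 0\<close> also for negative \<open>a\<close>; this is harmless because the neighborhoods are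
  only used together with \<open>0 < g\<close> and \<open>0 < f\<close> almost everywhere.
\<close>

definition alpha_nbhd :: "'a measure \<Rightarrow> real \<Rightarrow> real \<Rightarrow> ('a \<Rightarrow> real) \<Rightarrow> ('a \<Rightarrow> real) set" where
  "alpha_nbhd M \<alpha> \<epsilon> f =
     {g \<in> borel_measurable M. (AE x in M. 0 \<le> g x) \<and>
        integrable M (sym_alpha_integrand \<alpha> g f) \<and> sym_alpha_div M \<alpha> g f \<le> \<epsilon>}"

definition feasible :: "'a measure \<Rightarrow> real \<Rightarrow> real \<Rightarrow> ('a \<Rightarrow> real) \<Rightarrow> ('a \<Rightarrow> real) \<Rightarrow> bool" where
  "feasible M \<alpha> \<epsilon> f g \<longleftrightarrow>
     g \<in> alpha_nbhd M \<alpha> \<epsilon> f \<and> (AE x in M. 0 < g x) \<and> total_mass M g = 1"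

text \<open>
  The two maximizations for a given \<open>u\<close> are coupled: each density is optimal against the other.
\<close>

definition least_favorable ::
    "'a measure \<Rightarrow> real \<Rightarrow> real \<Rightarrow> real \<Rightarrow> real \<Rightarrow> ('a \<Rightarrow> real) \<Rightarrow> ('a \<Rightarrow> real) \<Rightarrow>
     ('a \<Rightarrow> real) \<Rightarrow> ('a \<Rightarrow> real) \<Rightarrow> bool" where
  "least_favorable M \<alpha> u \<epsilon>0 \<epsilon>1 f0 f1 g0 g1 \<longleftrightarrow>
     is_arg_max (\<lambda>g. u_affinity M u g g1) (feasible M \<alpha> \<epsilon>0 f0) g0 \<and>
     is_arg_max (\<lambda>g. u_affinity M u g0 g) (feasible M \<alpha> \<epsilon>1 f1) g1"

text \<open>
  In the Lagrangian, \<open>J\<close> is the \<open>u\<close>-affinity as a functional of the density that varies, and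
  \<open>lam\<close>, \<open>mu\<close> are the multipliers of the divergence and the mass constraint.
\<close>

definition lagrangian ::
    "'a measure \<Rightarrow> real \<Rightarrow> real \<Rightarrow> ('a \<Rightarrow> real) \<Rightarrow> (('a \<Rightarrow> real) \<Rightarrow> real) \<Rightarrow>
     real \<Rightarrow> real \<Rightarrow> ('a \<Rightarrow> real) \<Rightarrow> real" where
  "lagrangian M \<alpha> \<epsilon> f J lam mu g =
     J g + lam * (\<epsilon> - sym_alpha_div M \<alpha> g f) + mu * (1 - total_mass M g)"

text \<open>
  Vanishing Gateaux derivative. Directions are bounded relative to \<open>g\<close>, so that for small
  \<open>t\<close> of either sign \<open>g + t * \<psi>\<close> stays positive and its divergence stays finite; they are
  not required to preserve the total mass.
\<close>

definition gateaux_stationary ::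
    "'a measure \<Rightarrow> (('a \<Rightarrow> real) \<Rightarrow> real) \<Rightarrow> ('a \<Rightarrow> real) \<Rightarrow> bool" where
  "gateaux_stationary M L g \<longleftrightarrow>
     (\<forall>\<psi> \<in> borel_measurable M. (\<exists>c. AE x in M. \<bar>\<psi> x\<bar> \<le> c * g x) \<longrightarrow>
        ((\<lambda>t. L (\<lambda>x. g x + t * \<psi> x)) has_real_derivative 0) (at 0))"

text \<open>
  Primal feasibility, dual feasibility and complementary slackness; together with stationarity
  of the Lagrangian these are the KKT conditions.
\<close>

definition multiplier_conditions ::
    "'a measure \<Rightarrow> real \<Rightarrow> real \<Rightarrow> ('a \<Rightarrow> real) \<Rightarrow> real \<Rightarrow> ('a \<Rightarrow> real) \<Rightarrow> bool" where
  "multiplier_conditions M \<alpha> \<epsilon> f lam g \<longleftrightarrow>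
     feasible M \<alpha> \<epsilon> f g \<and> 0 \<le> lam \<and> lam * (\<epsilon> - sym_alpha_div M \<alpha> g f) = 0"

definition kkt ::
    "'a measure \<Rightarrow> real \<Rightarrow> real \<Rightarrow> ('a \<Rightarrow> real) \<Rightarrow> (('a \<Rightarrow> real) \<Rightarrow> real) \<Rightarrow>
     real \<Rightarrow> real \<Rightarrow> ('a \<Rightarrow> real) \<Rightarrow> bool" where
  "kkt M \<alpha> \<epsilon> f J lam mu g \<longleftrightarrow>
     multiplier_conditions M \<alpha> \<epsilon> f lam g \<and>
     gateaux_stationary M (lagrangian M \<alpha> \<epsilon> f J lam mu) g"

end

(*
  With one density h held fixed, the affinity J g = \<integral> h^u g^(1-u) is concave in g, the divergence
  D g is convex (for every \<alpha>, because of the factor 1 / (\<alpha> (1 - \<alpha>))), and the mass is linear, so each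
  of the two coupled problems is a convex program. Its two scalar constraints allow multipliers to
  be obtained by separating 0 from a convex subset of R^3; the nominal density f is a Slater point,
  and its multiples c f make the multiplier of the mass constraint nondegenerate. Conversely,
  stationarity is a pointwise equation, and a pointwise tangent inequality integrates to optimality.
  The second problem is the first one with u replaced by 1 - u.
*)

theory Submission
  imports Defs
begin

text \<open>The obstacle is integrability: the Lagrangian has to be differentiated at a density of
  which little more than a finite divergence is known, for every \<open>\<alpha>\<close> other than
  0 and 1. Directions bounded by a multiple of \<open>g\<close> remove it. They change
  \<open>g\<close> by a factor close to 1, so \<open>g powr p\<close> changes by at most a constant
  times itself, and a multiple of each integrand dominates its own difference quotients. These
  directions are still rich enough to force the pointwise equation, because \<open>g * sgn E\<close>
  is one of them, \<open>E\<close> being the density of the derivative. The multipliers are obtained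
  on the class \<open>admissible\<close>, free of both constraints, where the divergence splits into
  a linear part and two power integrals. Small perturbations of either sign stay in this class, so a
  global maximum of the Lagrangian is a two-sided local maximum along each direction.\<close>

section \<open>Differentiation of weighted power integrals under the integral sign\<close>

text \<open>By homogeneity, division by \<open>y\<close> reduces the claim to
  \<open>(1 + s) powr p - 1\<close> with \<open>s = d / y\<close>, where the derivative is bounded
  on the compact interval from 1/2 to 3/2. Hence \<open>K\<close> depends on \<open>p\<close>
  alone.\<close>

lemma powr_increment_bound:
  fixes p :: real
  obtains K where "0 \<le> K"
    and "\<And>y d. 0 < y \<Longrightarrow> \<bar>d\<bar> \<le> y / 2 \<Longrightarrow> \<bar>(y + d) powr p - y powr p\<bar> \<le> K * y powr p * (\<bar>d\<bar> / y)"
proof -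
  let ?S = "{1/2..3/2::real}"
  have "continuous_on ?S (\<lambda>z. p * z powr (p - 1))"
    by (intro continuous_intros) auto
  then have "bounded ((\<lambda>z. p * z powr (p - 1)) ` ?S)"
    by (intro compact_imp_bounded compact_continuous_image) auto
  then obtain K where "0 < K" and K: "\<And>z. z \<in> ?S \<Longrightarrow> norm (p * z powr (p - 1)) \<le> K"
    unfolding bounded_pos by auto
  have *: "\<bar>(1 + s) powr p - 1\<bar> \<le> K * \<bar>s\<bar>" if "\<bar>s\<bar> \<le> 1/2" for s
  proof -
    have "norm ((1 + s) powr p - 1 powr p) \<le> K * norm ((1 + s) - 1)"
    proof (rule field_differentiable_bound[of ?S _ "\<lambda>z. p * z powr (p - 1)"])
      fix z :: real assume "z \<in> ?S"
      then show "((\<lambda>z. z powr p) has_field_derivative p * z powr (p - 1)) (at z within ?S)"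
        by (auto intro!: derivative_eq_intros DERIV_subset[OF has_real_derivative_powr])
    qed (use K that in \<open>auto simp: abs_le_iff\<close>)
    then show ?thesis by simp
  qed
  have "\<bar>(y + d) powr p - y powr p\<bar> \<le> K * y powr p * (\<bar>d\<bar> / y)"
    if "0 < y" "\<bar>d\<bar> \<le> y / 2" for y d :: real
  proof -
    have s: "\<bar>d / y\<bar> \<le> 1/2" using that by (simp add: field_simps)
    then have "0 \<le> 1 + d / y" by linarith
    have "y + d = y * (1 + d / y)" using that by (simp add: field_simps)
    then have "(y + d) powr p = y powr p * (1 + d / y) powr p"
      using that \<open>0 \<le> 1 + d / y\<close> by (simp only: powr_mult)
    then have "(y + d) powr p - y powr p = y powr p * ((1 + d / y) powr p - 1)"
      by (simp add: right_diff_distrib)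
    then have "\<bar>(y + d) powr p - y powr p\<bar> = y powr p * \<bar>(1 + d / y) powr p - 1\<bar>"
      by (simp add: abs_mult)
    also have "\<dots> \<le> y powr p * (K * \<bar>d / y\<bar>)"
      by (intro mult_left_mono *[OF s]) auto
    finally show ?thesis using that by (simp add: mult_ac)
  qed
  then show thesis using that \<open>0 < K\<close> by (meson less_imp_le)
qed

text \<open>All nonlinear terms of the Lagrangian have the form of an integral of
  \<open>w * g powr p\<close>: the affinity with weight \<open>h powr u\<close>, and the two cross
  terms of the divergence with weights \<open>f powr \<alpha>\<close> and
  \<open>f powr (1 - \<alpha>)\<close>.\<close>

locale powr_functional =
  fixes M :: "'a measure" and w g \<psi> :: "'a \<Rightarrow> real" and p c :: real
  assumes meas [measurable]: "w \<in> borel_measurable M" "g \<in> borel_measurable M"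
      "\<psi> \<in> borel_measurable M"
    and pos: "AE x in M. 0 < g x"
    and int: "integrable M (\<lambda>x. w x * g x powr p)"
    and c: "0 < c" "AE x in M. \<bar>\<psi> x\<bar> \<le> c * g x"
begin

text \<open>The condition on \<open>t\<close> gives
  \<open>\<bar>t * \<psi> x\<bar> \<le> g x / 2\<close>, the range of the relative increment bound.
  One \<open>K\<close> serves all such \<open>t\<close>, as dominated convergence requires.\<close>

lemma increment_dominated:
  "\<exists>K\<ge>0. \<forall>t. \<bar>t\<bar> * c \<le> 1/2 \<longrightarrow> (AE x in M.
    \<bar>w x * (g x + t * \<psi> x) powr p - w x * g x powr p\<bar> \<le> \<bar>t\<bar> * (K * \<bar>w x * g x powr p\<bar>))"
proof -
  obtain K where "0 \<le> K" and K: "\<And>y d. 0 < y \<Longrightarrow> \<bar>d\<bar> \<le> y / 2 \<Longrightarrow>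
      \<bar>(y + d) powr p - y powr p\<bar> \<le> K * y powr p * (\<bar>d\<bar> / y)"
    using powr_increment_bound[of p] by blast
  have "AE x in M. \<bar>w x * (g x + t * \<psi> x) powr p - w x * g x powr p\<bar>
      \<le> \<bar>t\<bar> * ((K * c) * \<bar>w x * g x powr p\<bar>)"
    if t: "\<bar>t\<bar> * c \<le> 1/2" for t
    using pos c(2)
  proof eventually_elim
    case (elim x)
    have "\<bar>t\<bar> * \<bar>\<psi> x\<bar> \<le> (\<bar>t\<bar> * c) * g x"
      using elim(2) by (metis abs_ge_zero mult.assoc mult_left_mono)
    then have b: "\<bar>t * \<psi> x\<bar> \<le> (\<bar>t\<bar> * c) * g x" by (simp add: abs_mult)
    also have "\<dots> \<le> 1/2 * g x" using t elim(1) by (intro mult_right_mono) auto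
    finally have "\<bar>(g x + t * \<psi> x) powr p - g x powr p\<bar> \<le> K * g x powr p * (\<bar>t * \<psi> x\<bar> / g x)"
      using elim(1) by (intro K) auto
    also have "\<dots> \<le> K * g x powr p * (\<bar>t\<bar> * c)"
      using b elim(1) \<open>0 \<le> K\<close> by (intro mult_left_mono) (auto simp: divide_le_eq)
    finally have "\<bar>w x\<bar> * \<bar>(g x + t * \<psi> x) powr p - g x powr p\<bar>
        \<le> \<bar>w x\<bar> * (K * g x powr p * (\<bar>t\<bar> * c))"
      by (rule mult_left_mono) simp
    then show ?case
      by (simp add: abs_mult[symmetric] right_diff_distrib) (simp add: abs_mult mult_ac)
  qed
  moreover have "0 \<le> K * c" using \<open>0 \<le> K\<close> c(1) by simp
  ultimately show ?thesis by blast
qed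

lemma integrable_perturbed:
  assumes "\<bar>t\<bar> * c \<le> 1/2"
  shows "integrable M (\<lambda>x. w x * (g x + t * \<psi> x) powr p)"
proof -
  obtain K where "0 \<le> K" and K: "AE x in M.
      \<bar>w x * (g x + t * \<psi> x) powr p - w x * g x powr p\<bar> \<le> \<bar>t\<bar> * (K * \<bar>w x * g x powr p\<bar>)"
    using increment_dominated assms by blast
  have "integrable M (\<lambda>x. w x * (g x + t * \<psi> x) powr p - w x * g x powr p)"
  proof (rule Bochner_Integration.integrable_bound)
    show "integrable M (\<lambda>x. \<bar>t\<bar> * (K * \<bar>w x * g x powr p\<bar>))"
      using int by (intro integrable_mult_right integrable_abs) auto
    show "AE x in M. norm (w x * (g x + t * \<psi> x) powr p - w x * g x powr p)
        \<le> norm (\<bar>t\<bar> * (K * \<bar>w x * g x powr p\<bar>))"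
      using K by eventually_elim (use \<open>0 \<le> K\<close> in \<open>simp add: abs_mult\<close>)
  qed measurable
  from Bochner_Integration.integrable_add[OF this int] show ?thesis by simp
qed

lemma integrable_derivative: "integrable M (\<lambda>x. w x * (p * g x powr (p - 1) * \<psi> x))"
proof (rule Bochner_Integration.integrable_bound)
  show "integrable M (\<lambda>x. (\<bar>p\<bar> * c) * \<bar>w x * g x powr p\<bar>)"
    using int by (intro integrable_mult_right integrable_abs) auto
  show "AE x in M. norm (w x * (p * g x powr (p - 1) * \<psi> x)) \<le> norm ((\<bar>p\<bar> * c) * \<bar>w x * g x powr p\<bar>)"
    using pos c(2)
  proof eventually_elim
    case (elim x)
    have "g x powr (p - 1) * \<bar>\<psi> x\<bar> \<le> g x powr (p - 1) * (c * g x)"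
      using elim by (intro mult_left_mono) auto
    also have "\<dots> = c * g x powr p"
      using elim powr_mult_base[of "g x" "p - 1"] by (simp add: mult_ac)
    finally have "\<bar>w x * p\<bar> * (g x powr (p - 1) * \<bar>\<psi> x\<bar>) \<le> \<bar>w x * p\<bar> * (c * g x powr p)"
      by (rule mult_left_mono) simp
    then show ?case using c(1) by (simp add: abs_mult mult_ac)
  qed
qed measurable

lemma has_derivative_at_0:
  "((\<lambda>t. \<integral>x. w x * (g x + t * \<psi> x) powr p \<partial>M) has_real_derivative
     (\<integral>x. w x * (p * g x powr (p - 1) * \<psi> x) \<partial>M)) (at 0)"
  unfolding DERIV_def tendsto_at_iff_sequentially
proof (intro allI impI)
  fix X :: "nat \<Rightarrow> real"
  assume X0: "\<forall>i. X i \<in> UNIV - {0}" and X: "X \<longlonglongrightarrow> 0"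
  obtain K where "0 \<le> K" and K: "\<And>t. \<bar>t\<bar> * c \<le> 1/2 \<Longrightarrow> AE x in M.
      \<bar>w x * (g x + t * \<psi> x) powr p - w x * g x powr p\<bar> \<le> \<bar>t\<bar> * (K * \<bar>w x * g x powr p\<bar>)"
    using increment_dominated by blast
  have "(\<lambda>i. \<bar>X i\<bar> * c) \<longlonglongrightarrow> \<bar>0\<bar> * c" by (intro tendsto_intros X)
  then have "\<forall>\<^sub>F i in sequentially. \<bar>X i\<bar> * c < 1/2"
    by (rule order_tendstoD) simp
  \<comment> \<open>The domination holds only for small increments, so the first \<open>N\<close>
    terms are dropped; \<open>LIMSEQ_offset\<close> restores them at the end.\<close>
  then obtain N where N: "\<And>i. \<bar>X (i + N)\<bar> * c \<le> 1/2"
    unfolding eventually_sequentially by (metis le_add2 less_imp_le)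
  let ?q = "\<lambda>t x. (w x * (g x + t * \<psi> x) powr p - w x * g x powr p) / t"
  have "(\<lambda>i. \<integral>x. ?q (X (i + N)) x \<partial>M) \<longlonglongrightarrow> (\<integral>x. w x * (p * g x powr (p - 1) * \<psi> x) \<partial>M)"
  proof (rule integral_dominated_convergence)
    show "integrable M (\<lambda>x. K * \<bar>w x * g x powr p\<bar>)"
      using int by (intro integrable_mult_right integrable_abs) auto
    show "AE x in M. (\<lambda>i. ?q (X (i + N)) x) \<longlonglongrightarrow> w x * (p * g x powr (p - 1) * \<psi> x)"
      using pos
    proof eventually_elim
      case (elim x)
      have "((\<lambda>t. w x * (g x + t * \<psi> x) powr p) has_real_derivative
          w x * (p * g x powr (p - 1) * \<psi> x)) (at 0)"
        using elim by (auto intro!: derivative_eq_intros simp: powr_diff)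
      then have "((\<lambda>t. ?q t x) \<longlongrightarrow> w x * (p * g x powr (p - 1) * \<psi> x)) (at 0)"
        unfolding DERIV_def by simp
      then show ?case
        unfolding tendsto_at_iff_sequentially
        using X0 LIMSEQ_ignore_initial_segment[OF X, of N] by (auto simp: comp_def)
    qed
    show "AE x in M. norm (?q (X (i + N)) x) \<le> K * \<bar>w x * g x powr p\<bar>" for i
      using K[OF N[of i]]
    proof eventually_elim
      case (elim x)
      have "X (i + N) \<noteq> 0" using X0 by blast
      with elim show ?case by (simp add: divide_le_eq mult_ac)
    qed
  qed measurable
  moreover have "(\<integral>x. ?q (X (i + N)) x \<partial>M) = ((\<integral>x. w x * (g x + X (i + N) * \<psi> x) powr p \<partial>M)
      - (\<integral>x. w x * g x powr p \<partial>M)) / X (i + N)" for i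
    using integrable_perturbed[OF N[of i]] int by simp
  ultimately have "(\<lambda>i. ((\<integral>x. w x * (g x + X (i + N) * \<psi> x) powr p \<partial>M)
      - (\<integral>x. w x * g x powr p \<partial>M)) / X (i + N)) \<longlonglongrightarrow> (\<integral>x. w x * (p * g x powr (p - 1) * \<psi> x) \<partial>M)"
    by (simp only:)
  then show "((\<lambda>h. ((\<integral>x. w x * (g x + (0 + h) * \<psi> x) powr p \<partial>M)
      - (\<integral>x. w x * (g x + 0 * \<psi> x) powr p \<partial>M)) / h) \<circ> X)
      \<longlonglongrightarrow> (\<integral>x. w x * (p * g x powr (p - 1) * \<psi> x) \<partial>M)"
    by - (rule LIMSEQ_offset[of _ N], simp add: comp_def)
qed

end

section \<open>Convexity of powers, and multipliers for an abstract convex program\<close>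

text \<open>The hypothesis is the sign of the second derivative. Keeping \<open>a\<close> inside it
  treats the concave affinity (\<open>a = -1\<close>) and the divergence terms, whose exponents may
  lie inside or outside the unit interval, alike.\<close>

lemma convex_on_mult_powr:
  fixes a p :: real
  assumes "0 \<le> a * (p * (p - 1))"
  shows "convex_on {0<..} (\<lambda>y. a * y powr p)"
proof (rule f''_ge0_imp_convex)
  fix y :: real assume y: "y \<in> {0<..}"
  then show "((\<lambda>y. a * y powr p) has_real_derivative a * (p * y powr (p - 1))) (at y)"
    by (auto intro!: derivative_eq_intros simp: powr_diff)
  from y show "((\<lambda>y. a * (p * y powr (p - 1))) has_real_derivative
      (a * (p * (p - 1))) * y powr (p - 2)) (at y)"
    using DERIV_cmult[OF has_real_derivative_powr[of y "p - 1"], of "a * p"] by (simp add: mult_ac)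
  show "0 \<le> (a * (p * (p - 1))) * y powr (p - 2)" using assms by (rule mult_nonneg_nonneg) simp
qed simp

text \<open>A separating normal \<open>(p, q, r)\<close> has \<open>p\<close> and \<open>q\<close>
  nonnegative because the separated set is upward closed in its first two coordinates;
  \<open>slater\<close> excludes \<open>p = 0\<close>, and division by \<open>p\<close> gives the
  multipliers. The class \<open>C\<close> needs no linear structure, only points that do at least as
  well as mixtures.\<close>

lemma convex_program_multipliers:
  fixes J D T :: "'b \<Rightarrow> real"
  assumes convexlike: "\<And>g h s. g \<in> C \<Longrightarrow> h \<in> C \<Longrightarrow> 0 \<le> s \<Longrightarrow> s \<le> 1 \<Longrightarrow>
      \<exists>k\<in>C. s * J g + (1 - s) * J h \<le> J k \<and> D k \<le> s * D g + (1 - s) * D h \<and>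
        T k = s * T g + (1 - s) * T h"
    and opt: "g \<in> C" "D g \<le> \<epsilon>" "T g = m"
      "\<And>k. k \<in> C \<Longrightarrow> D k \<le> \<epsilon> \<Longrightarrow> T k = m \<Longrightarrow> J k \<le> J g"
    and slater: "s \<in> C" "D s < \<epsilon>" "T s = m" "a \<in> C" "T a < m" "b \<in> C" "m < T b"
  obtains lam mu where "0 \<le> lam" "lam * (\<epsilon> - D g) = 0"
    "\<And>k. k \<in> C \<Longrightarrow> J k + lam * (\<epsilon> - D k) + mu * (m - T k) \<le> J g"
proof -
  \<comment> \<open>The strict inequality in the first coordinate keeps 0 out: with a weak one,
    \<open>k = g\<close> would put it in the set.\<close>
  let ?S = "{(x, y, z). \<exists>k\<in>C. J g - J k < x \<and> D k - \<epsilon> \<le> y \<and> z = T k - m}"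
  have "convex ?S"
  proof (rule convexI)
    fix v1 v2 :: "real \<times> real \<times> real" and s t :: real
    assume v: "v1 \<in> ?S" "v2 \<in> ?S" and st: "0 \<le> s" "0 \<le> t" "s + t = 1"
    obtain x1 y1 z1 x2 y2 z2 where [simp]: "v1 = (x1, y1, z1)" "v2 = (x2, y2, z2)"
      by (metis surj_pair)
    from v obtain k1 k2 where k1: "k1 \<in> C" "J g - J k1 < x1" "D k1 - \<epsilon> \<le> y1" "z1 = T k1 - m"
      and k2: "k2 \<in> C" "J g - J k2 < x2" "D k2 - \<epsilon> \<le> y2" "z2 = T k2 - m" by auto
    have t: "t = 1 - s" using st by simp
    obtain k where k: "k \<in> C" "s * J k1 + t * J k2 \<le> J k" "D k \<le> s * D k1 + t * D k2"
      "T k = s * T k1 + t * T k2"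
      using convexlike[OF k1(1) k2(1), of s] st t by auto
    have "s * (J g - J k1) + t * (J g - J k2) < s * x1 + t * x2"
    \<comment> \<open>With weight 0 the first strict inequality is lost, and strictness must come
      from the second point.\<close>
    proof (cases "s = 0")
      case True then show ?thesis using k2 t by simp
    next
      case False
      then show ?thesis using k1(2) k2(2) st
        by (intro add_less_le_mono mult_strict_left_mono mult_left_mono) auto
    qed
    then have "J g - J k < s * x1 + t * x2" using k(2) by (simp add: t algebra_simps)
    moreover have "s * (D k1 - \<epsilon>) + t * (D k2 - \<epsilon>) \<le> s * y1 + t * y2"
      using k1 k2 st by (intro add_mono mult_left_mono) auto
    then have "D k - \<epsilon> \<le> s * y1 + t * y2" using k(3) by (simp add: t algebra_simps)
    moreover have "s * z1 + t * z2 = T k - m"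
      unfolding k1(4) k2(4) k(4) by (simp add: t algebra_simps)
    ultimately show "s *\<^sub>R v1 + t *\<^sub>R v2 \<in> ?S" using k(1) by auto
  qed
  moreover have "0 \<notin> ?S"
  proof
    assume "0 \<in> ?S"
    then obtain k where "k \<in> C" "J g < J k" "D k \<le> \<epsilon>" "T k = m" by (auto simp: zero_prod_def)
    then show False using opt(4)[of k] by simp
  qed
  ultimately have "\<exists>v. v \<noteq> 0 \<and> (\<forall>x\<in>?S. 0 \<le> v \<bullet> x)"
    by (rule separating_hyperplane_set_0)
  then obtain v :: "real \<times> real \<times> real" where "v \<noteq> 0" and v: "\<forall>x\<in>?S. 0 \<le> v \<bullet> x"
    by (elim exE conjE)
  obtain p q r where pqr: "v = (p, q, r)" by (metis surj_pair)
  have S: "0 \<le> p * x + q * y + r * (T k - m)" if "k \<in> C" "J g - J k < x" "D k - \<epsilon> \<le> y" for k x y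
  proof -
    have "(x, y, T k - m) \<in> ?S" using that by blast
    with v have "0 \<le> v \<bullet> (x, y, T k - m)" by blast
    then show ?thesis by (simp add: pqr)
  qed
  have "0 \<le> p"
  proof (rule ccontr)
    assume "\<not> 0 \<le> p"
    \<comment> \<open>At \<open>k = g\<close> the mass term vanishes and every positive
      \<open>x\<close> is allowed; this one makes \<open>p * x\<close> outweigh the remaining term
      \<open>B\<close>.\<close>
    define B where "B = q * (D g - \<epsilon>)"
    define x where "x = (\<bar>B\<bar> + 1) / - p"
    have "0 < x" "p * x = - (\<bar>B\<bar> + 1)"
      unfolding x_def using \<open>\<not> 0 \<le> p\<close> by (intro divide_pos_pos, simp_all)
    then show False using S[OF opt(1), of x "D g - \<epsilon>"] opt(3) by (simp add: B_def)
  qed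
  have "0 \<le> q"
  proof (rule ccontr)
    assume "\<not> 0 \<le> q"
    \<comment> \<open>Here \<open>x = 1\<close> contributes \<open>p\<close>, which
      \<open>q * y = - (\<bar>p\<bar> + 1)\<close> outweighs; positive \<open>y\<close> are allowed
      because \<open>D g \<le> \<epsilon>\<close>.\<close>
    define y where "y = (\<bar>p\<bar> + 1) / - q"
    have "0 < y" "q * y = - (\<bar>p\<bar> + 1)"
      unfolding y_def using \<open>\<not> 0 \<le> q\<close> by (intro divide_pos_pos, simp_all)
    then show False using S[OF opt(1), of 1 y] opt(2,3) by simp
  qed
  \<comment> \<open>The strict inequality is relaxed by a limit. The denominator
    \<open>p + 1\<close> is used because \<open>p = 0\<close> is not yet excluded.\<close>
  have L: "0 \<le> p * (J g - J k) + q * (D k - \<epsilon>) + r * (T k - m)" if "k \<in> C" for k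
  proof (rule field_le_epsilon)
    fix e :: real assume "0 < e"
    have "0 \<le> p * (J g - J k + e / (p + 1)) + q * (D k - \<epsilon>) + r * (T k - m)"
      using \<open>0 < e\<close> \<open>0 \<le> p\<close> that by (intro S) auto
    also have "p * (J g - J k + e / (p + 1)) \<le> p * (J g - J k) + e"
      using \<open>0 < e\<close> \<open>0 \<le> p\<close> by (simp add: field_simps)
    finally show "0 \<le> p * (J g - J k) + q * (D k - \<epsilon>) + r * (T k - m) + e" by simp
  qed
  have "p \<noteq> 0"
  proof
    \<comment> \<open>The Slater point then forces \<open>q = 0\<close>, and the points
      \<open>a\<close>, \<open>b\<close> with mass below and above \<open>m\<close> force
      \<open>r = 0\<close>, so the normal would vanish.\<close>
    assume [simp]: "p = 0"
    have "0 \<le> q * (D s - \<epsilon>)" using L[OF slater(1)] slater(3) by simp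
    then have [simp]: "q = 0" using \<open>0 \<le> q\<close> slater(2) by (simp add: zero_le_mult_iff)
    have "r = 0"
      using L[OF slater(4)] L[OF slater(6)] slater(5,7) by (auto simp: zero_le_mult_iff)
    then show False using \<open>v \<noteq> 0\<close> pqr by (simp add: zero_prod_def)
  qed
  with \<open>0 \<le> p\<close> have "0 < p" by simp
  have "q * (D g - \<epsilon>) \<le> 0" using \<open>0 \<le> q\<close> opt(2) by (simp add: mult_le_0_iff)
  moreover have "0 \<le> q * (D g - \<epsilon>)" using L[OF opt(1)] opt(3) by simp
  ultimately have cs: "q * (D g - \<epsilon>) = 0" by simp
  show thesis
  proof (rule that[of "q / p" "r / p"])
    show "0 \<le> q / p" using \<open>0 < p\<close> \<open>0 \<le> q\<close> by simp
    show "q / p * (\<epsilon> - D g) = 0" using cs by auto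
    show "J k + q / p * (\<epsilon> - D k) + r / p * (m - T k) \<le> J g" if "k \<in> C" for k
    proof -
      have "p * (J k + q / p * (\<epsilon> - D k) + r / p * (m - T k)) = p * J k + q * (\<epsilon> - D k) + r * (m - T k)"
        using \<open>p \<noteq> 0\<close> by (simp add: distrib_left)
      also have "\<dots> \<le> p * J g" using L[OF that] by (simp add: algebra_simps)
      finally show ?thesis using \<open>0 < p\<close> by simp
    qed
  qed
qed

section \<open>Tangent, mixture and integrated convexity inequalities for powers\<close>

lemma convex_mult_powr_tangent:
  fixes a p y z :: real
  assumes "0 \<le> a * (p * (p - 1))" "0 < y" "0 < z"
  shows "a * y powr p + a * p * y powr (p - 1) * (z - y) \<le> a * z powr p"
proof -
  have "((\<lambda>y. a * y powr p) has_real_derivative a * p * y powr (p - 1)) (at y within {0<..})"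
    using DERIV_cmult[OF has_real_derivative_powr[OF assms(2), of p], of a]
    by (auto intro: DERIV_subset simp: mult_ac)
  then have "a * p * y powr (p - 1) * (z - y) \<le> a * z powr p - a * y powr p"
    using assms by (intro convex_on_imp_above_tangent[OF convex_on_mult_powr[OF assms(1)]])
      (auto simp: interior_open)
  then show ?thesis by simp
qed

text \<open>A power is monotone on the positive reals, so its maximum over a segment is attained at
  an endpoint and is at most the sum of both endpoint values. This gives mixtures an integrable
  majorant for exponents of either sign.\<close>

lemma powr_convex_combination_le:
  fixes y z s p :: real
  assumes "0 < y" "0 < z" "0 \<le> s" "s \<le> 1"
  shows "(s * y + (1 - s) * z) powr p \<le> y powr p + z powr p"
proof -
  have *: "(s * y + (1 - s) * z) powr p \<le> y powr p + z powr p"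
    if "0 < y" "y \<le> z" "0 \<le> s" "s \<le> 1" for y z s :: real
  proof -
    have "s * (z - y) \<le> 1 * (z - y)" "0 \<le> s * (z - y)"
      using that by (intro mult_right_mono mult_nonneg_nonneg; simp)+
    then have "y \<le> s * y + (1 - s) * z" "s * y + (1 - s) * z \<le> z"
      by (simp_all add: algebra_simps)
    then have "(s * y + (1 - s) * z) powr p \<le> (if 0 \<le> p then z powr p else y powr p)"
      using that by (auto intro: powr_mono2 powr_mono2')
    also have "\<dots> \<le> y powr p + z powr p" by simp
    finally show ?thesis .
  qed
  show ?thesis
  proof (cases "y \<le> z")
    case True then show ?thesis using * assms by blast
  next
    case False then show ?thesis using *[of z y "1 - s"] assms by (simp add: add.commute)
  qed
qed

lemma integrable_powr_convex_combination:
  fixes w g k :: "'a \<Rightarrow> real"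
  assumes [measurable]: "w \<in> borel_measurable M" "g \<in> borel_measurable M" "k \<in> borel_measurable M"
    and "AE x in M. 0 \<le> w x" "AE x in M. 0 < g x" "AE x in M. 0 < k x" and s: "0 \<le> s" "s \<le> 1"
    and "integrable M (\<lambda>x. w x * g x powr p)" "integrable M (\<lambda>x. w x * k x powr p)"
  shows "integrable M (\<lambda>x. w x * (s * g x + (1 - s) * k x) powr p)"
proof (rule Bochner_Integration.integrable_bound)
  show "integrable M (\<lambda>x. w x * g x powr p + w x * k x powr p)" using assms by simp
  show "AE x in M. norm (w x * (s * g x + (1 - s) * k x) powr p) \<le> norm (w x * g x powr p + w x * k x powr p)"
    using assms(4-6)
  proof eventually_elim
    case (elim x)
    then have "w x * (s * g x + (1 - s) * k x) powr p \<le> w x * (g x powr p + k x powr p)"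
      using s by (intro mult_left_mono powr_convex_combination_le) auto
    then show ?case using elim by (simp add: distrib_left)
  qed
qed measurable

lemma integral_powr_convex:
  fixes w g k :: "'a \<Rightarrow> real"
  assumes meas: "w \<in> borel_measurable M" "g \<in> borel_measurable M" "k \<in> borel_measurable M"
    and pos: "AE x in M. 0 \<le> w x" "AE x in M. 0 < g x" "AE x in M. 0 < k x" and s: "0 \<le> s" "s \<le> 1"
    and int: "integrable M (\<lambda>x. w x * g x powr p)" "integrable M (\<lambda>x. w x * k x powr p)"
    and a: "0 \<le> a * (p * (p - 1))"
  shows "a * (\<integral>x. w x * (s * g x + (1 - s) * k x) powr p \<partial>M) \<le>
    s * (a * (\<integral>x. w x * g x powr p \<partial>M)) + (1 - s) * (a * (\<integral>x. w x * k x powr p \<partial>M))"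
proof -
  have "(\<integral>x. a * (w x * (s * g x + (1 - s) * k x) powr p) \<partial>M) \<le>
      (\<integral>x. s * (a * (w x * g x powr p)) + (1 - s) * (a * (w x * k x powr p)) \<partial>M)"
  proof (rule integral_mono_AE)
    show "integrable M (\<lambda>x. a * (w x * (s * g x + (1 - s) * k x) powr p))"
      by (intro integrable_mult_right integrable_powr_convex_combination assms)
    show "AE x in M. a * (w x * (s * g x + (1 - s) * k x) powr p)
        \<le> s * (a * (w x * g x powr p)) + (1 - s) * (a * (w x * k x powr p))"
      using pos
    proof eventually_elim
      case (elim x)
      have "a * (s * g x + (1 - s) * k x) powr p
          \<le> s * (a * g x powr p) + (1 - s) * (a * k x powr p)"
        using convex_onD[OF convex_on_mult_powr[OF a], of "1 - s" "g x" "k x"] s elim by simp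
      then have "w x * (a * (s * g x + (1 - s) * k x) powr p)
          \<le> w x * (s * (a * g x powr p) + (1 - s) * (a * k x powr p))"
        using elim by (intro mult_left_mono) auto
      then show ?case by (simp add: algebra_simps)
    qed
  qed (use int in auto)
  also have "\<dots> = s * (a * (\<integral>x. w x * g x powr p \<partial>M)) + (1 - s) * (a * (\<integral>x. w x * k x powr p \<partial>M))"
    using int by simp
  finally show ?thesis by simp
qed

text \<open>\<open>gateaux_stationary\<close> leaves the sign of \<open>c\<close> open, while the
  step size \<open>1 / (2 * c)\<close> used later needs it positive.\<close>

lemma relative_bound_pos:
  fixes \<psi> g :: "'a \<Rightarrow> real"
  assumes "\<exists>c. AE x in M. \<bar>\<psi> x\<bar> \<le> c * g x" "AE x in M. 0 < g x"
  shows "\<exists>c>0. AE x in M. \<bar>\<psi> x\<bar> \<le> c * g x"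
proof -
  obtain c where "AE x in M. \<bar>\<psi> x\<bar> \<le> c * g x" using assms(1) by blast
  then have "AE x in M. \<bar>\<psi> x\<bar> \<le> max 1 c * g x"
    using assms(2)
  proof eventually_elim
    case (elim x)
    have "c * g x \<le> max 1 c * g x" using elim(2) by (intro mult_right_mono) simp_all
    with elim(1) show ?case by linarith
  qed
  then show ?thesis by (intro exI[of _ "max 1 c"]) simp
qed

section \<open>One maximization with the other density fixed: admissible class and convexity\<close>

locale affinity_problem =
  fixes M :: "'a measure" and \<alpha> u \<epsilon> :: real and f h :: "'a \<Rightarrow> real"
  assumes \<alpha>: "\<alpha> \<noteq> 0" "\<alpha> \<noteq> 1" and u: "0 < u" "u < 1" and \<epsilon>: "0 < \<epsilon>"
    and f [measurable]: "f \<in> borel_measurable M" and f_pos: "AE x in M. 0 < f x"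
    and f_mass: "total_mass M f = 1"
    and h [measurable]: "h \<in> borel_measurable M" and h_pos: "AE x in M. 0 < h x"
    and h_int: "integrable M h"
begin

text \<open>Neither mass nor divergence bound is imposed here: this is the domain on which affinity,
  divergence and mass are all genuine integrals, not default values.\<close>

definition admissible :: "('a \<Rightarrow> real) \<Rightarrow> bool" where
  "admissible g \<longleftrightarrow> g \<in> borel_measurable M \<and> (AE x in M. 0 < g x) \<and> integrable M g \<and>
     integrable M (\<lambda>x. f x powr \<alpha> * g x powr (1 - \<alpha>)) \<and>
     integrable M (\<lambda>x. f x powr (1 - \<alpha>) * g x powr \<alpha>)"

text \<open>The pointwise derivative in \<open>g x\<close> of the integrand of the Lagrangian;
  integrated against \<open>\<psi>\<close> it gives the Gateaux derivative.\<close>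

definition L_deriv :: "real \<Rightarrow> real \<Rightarrow> ('a \<Rightarrow> real) \<Rightarrow> 'a \<Rightarrow> real" where
  "L_deriv lam mu g x = h x powr u * ((1 - u) * g x powr (- u))
     - lam / (\<alpha> * (1 - \<alpha>)) * (1 - f x powr \<alpha> * ((1 - \<alpha>) * g x powr (- \<alpha>))
         - f x powr (1 - \<alpha>) * (\<alpha> * g x powr (\<alpha> - 1))) - mu"

abbreviation "L \<equiv> lagrangian M \<alpha> \<epsilon> f (\<lambda>g. u_affinity M u g h)"

lemma admissibleD:
  assumes "admissible g"
  shows "g \<in> borel_measurable M" "AE x in M. 0 < g x" "integrable M g"
    "integrable M (\<lambda>x. f x powr \<alpha> * g x powr (1 - \<alpha>))"
    "integrable M (\<lambda>x. f x powr (1 - \<alpha>) * g x powr \<alpha>)"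
  using assms unfolding admissible_def by simp_all

text \<open>A non-integrable function has integral 0, so mass 1 already forces integrability. The
  same argument serves the feasible densities below.\<close>

lemma f_int: "integrable M f"
  using f_mass unfolding total_mass_def by (metis not_integrable_integral_eq zero_neq_one)

lemma integrand_eq:
  assumes "0 < f x" "0 < g x"
  shows "sym_alpha_integrand \<alpha> g f x =
    f x + g x - f x powr \<alpha> * g x powr (1 - \<alpha>) - f x powr (1 - \<alpha>) * g x powr \<alpha>"
proof -
  have "f x powr \<alpha> * f x powr (1 - \<alpha>) = f x" "g x powr \<alpha> * g x powr (1 - \<alpha>) = g x"
    using assms by (simp_all flip: powr_add)
  then show ?thesis unfolding sym_alpha_integrand_def by (simp add: algebra_simps)
qed

lemma AE_integrand_eq:
  assumes "AE x in M. 0 < g x"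
  shows "AE x in M. sym_alpha_integrand \<alpha> g f x =
    f x + g x - f x powr \<alpha> * g x powr (1 - \<alpha>) - f x powr (1 - \<alpha>) * g x powr \<alpha>"
  using f_pos assms by eventually_elim (rule integrand_eq)

lemma measurable_integrand [measurable]:
  assumes [measurable]: "g \<in> borel_measurable M"
  shows "sym_alpha_integrand \<alpha> g f \<in> borel_measurable M"
proof -
  have "sym_alpha_integrand \<alpha> g f =
      (\<lambda>x. (f x powr \<alpha> - g x powr \<alpha>) * (f x powr (1 - \<alpha>) - g x powr (1 - \<alpha>)))"
    by (simp add: fun_eq_iff sym_alpha_integrand_def)
  then show ?thesis by simp
qed

text \<open>Expanding the product leaves \<open>f + g\<close> minus two nonnegative cross terms. As
  \<open>f + g\<close> is integrable, so is the sum of the cross terms, and it dominates each of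
  them.\<close>

lemma integrable_integrand_iff:
  assumes [measurable]: "g \<in> borel_measurable M" and pos: "AE x in M. 0 < g x" and int: "integrable M g"
  shows "integrable M (sym_alpha_integrand \<alpha> g f) \<longleftrightarrow> admissible g"
proof -
  let ?A = "\<lambda>x. f x powr \<alpha> * g x powr (1 - \<alpha>)" and ?B = "\<lambda>x. f x powr (1 - \<alpha>) * g x powr \<alpha>"
  have "integrable M (sym_alpha_integrand \<alpha> g f) \<longleftrightarrow> integrable M (\<lambda>x. f x + g x - ?A x - ?B x)"
    using AE_integrand_eq[OF pos] by (intro integrable_cong_AE) auto
  moreover have "integrable M ?A \<and> integrable M ?B" if "integrable M (\<lambda>x. f x + g x - ?A x - ?B x)"
  proof -
    have "integrable M (\<lambda>x. (f x + g x) - (f x + g x - ?A x - ?B x))"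
      by (rule Bochner_Integration.integrable_diff[OF Bochner_Integration.integrable_add[OF f_int int] that])
    then have i: "integrable M (\<lambda>x. ?A x + ?B x)" by simp
    show ?thesis by (intro conjI Bochner_Integration.integrable_bound[OF i] AE_I2) auto
  qed
  moreover have "integrable M (\<lambda>x. f x + g x - ?A x - ?B x)" if "integrable M ?A" "integrable M ?B"
    by (intro Bochner_Integration.integrable_diff Bochner_Integration.integrable_add f_int int that)
  ultimately show ?thesis unfolding admissible_def using assms by blast
qed

lemma feasible_iff:
  "feasible M \<alpha> \<epsilon> f g \<longleftrightarrow> admissible g \<and> sym_alpha_div M \<alpha> g f \<le> \<epsilon> \<and> total_mass M g = 1"
proof -
  have "integrable M g" if "total_mass M g = 1"
    using that unfolding total_mass_def by (metis not_integrable_integral_eq zero_neq_one)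
  moreover have "AE x in M. 0 \<le> g x" if "AE x in M. 0 < g x"
    using that by eventually_elim simp
  ultimately show ?thesis
    unfolding feasible_def alpha_nbhd_def mem_Collect_eq
    using integrable_integrand_iff[of g] admissibleD[of g] by blast
qed

lemma sym_alpha_div_eq:
  assumes "admissible g"
  shows "sym_alpha_div M \<alpha> g f = 1 / (\<alpha> * (1 - \<alpha>)) * (1 + (\<integral>x. g x \<partial>M)
    - (\<integral>x. f x powr \<alpha> * g x powr (1 - \<alpha>) \<partial>M) - (\<integral>x. f x powr (1 - \<alpha>) * g x powr \<alpha> \<partial>M))"
proof -
  note [measurable] = admissibleD(1)[OF assms]
  have "(\<integral>x. sym_alpha_integrand \<alpha> g f x \<partial>M) = (\<integral>x. f x + g x - f x powr \<alpha> * g x powr (1 - \<alpha>)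
      - f x powr (1 - \<alpha>) * g x powr \<alpha> \<partial>M)"
    by (intro integral_cong_AE AE_integrand_eq admissibleD(2)[OF assms]) simp_all
  then show ?thesis
    using admissibleD[OF assms] f_int f_mass unfolding sym_alpha_div_def total_mass_def by simp
qed

text \<open>Both bases are at most \<open>h + g\<close> and the exponents are positive with sum 1,
  so \<open>h + g\<close> itself is a majorant.\<close>

lemma integrable_affinity:
  assumes "admissible g"
  shows "integrable M (\<lambda>x. h x powr u * g x powr (1 - u))"
proof (rule Bochner_Integration.integrable_bound)
  note [measurable] = admissibleD(1)[OF assms]
  show "integrable M (\<lambda>x. h x + g x)" using h_int admissibleD(3)[OF assms] by simp
  show "AE x in M. norm (h x powr u * g x powr (1 - u)) \<le> norm (h x + g x)"
    using h_pos admissibleD(2)[OF assms]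
  proof eventually_elim
    case (elim x)
    have "h x powr u * g x powr (1 - u) \<le> (h x + g x) powr u * (h x + g x) powr (1 - u)"
      using elim u by (intro mult_mono powr_mono2) auto
    also have "\<dots> = h x + g x" using elim by (simp flip: powr_add)
    finally show ?case using elim by simp
  qed
  show "(\<lambda>x. h x powr u * g x powr (1 - u)) \<in> borel_measurable M" by measurable
qed

lemma admissible_convex_combination:
  assumes "admissible g" "admissible k" "0 \<le> s" "s \<le> 1"
  shows "admissible (\<lambda>x. s * g x + (1 - s) * k x)"
proof -
  note g = admissibleD[OF assms(1)] and k = admissibleD[OF assms(2)]
  note [measurable] = g(1) k(1)
  have "AE x in M. 0 < s * g x + (1 - s) * k x"
    using g(2) k(2)
  proof eventually_elim
    case (elim x)
    show ?case
    proof (cases "s = 0")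
      case False
      then show ?thesis using elim assms(3,4)
        by (intro add_pos_nonneg mult_pos_pos mult_nonneg_nonneg) simp_all
    qed (use elim in simp)
  qed
  moreover have "integrable M (\<lambda>x. s * g x + (1 - s) * k x)" using g(3) k(3) by simp
  moreover have "integrable M (\<lambda>x. f x powr \<alpha> * (s * g x + (1 - s) * k x) powr (1 - \<alpha>))"
    "integrable M (\<lambda>x. f x powr (1 - \<alpha>) * (s * g x + (1 - s) * k x) powr \<alpha>)"
    by (intro integrable_powr_convex_combination g k assms(3,4) AE_I2; simp)+
  ultimately show ?thesis unfolding admissible_def by simp
qed

lemma convexlike:
  assumes g: "admissible g" and k: "admissible k" and s: "0 \<le> s" "s \<le> 1"
  defines "c \<equiv> \<lambda>x. s * g x + (1 - s) * k x"
  shows "s * u_affinity M u g h + (1 - s) * u_affinity M u k h \<le> u_affinity M u c h"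
    and "sym_alpha_div M \<alpha> c f \<le> s * sym_alpha_div M \<alpha> g f + (1 - s) * sym_alpha_div M \<alpha> k f"
    and "total_mass M c = s * total_mass M g + (1 - s) * total_mass M k"
proof -
  note gk = admissibleD[OF g] admissibleD[OF k]
  note [measurable] = gk(1,6)
  have c: "admissible c" unfolding c_def by (intro admissible_convex_combination g k s)
  show T: "total_mass M c = s * total_mass M g + (1 - s) * total_mass M k"
    using gk(3,8) unfolding total_mass_def c_def by simp
  have "(-1) * u_affinity M u c h \<le> s * ((-1) * u_affinity M u g h) + (1 - s) * ((-1) * u_affinity M u k h)"
    unfolding u_affinity_def c_def using u
    by (intro integral_powr_convex integrable_affinity g k s gk AE_I2) (simp_all add: mult_le_0_iff)
  then show "s * u_affinity M u g h + (1 - s) * u_affinity M u k h \<le> u_affinity M u c h"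
    by simp
  let ?b = "1 / (\<alpha> * (1 - \<alpha>))"
  let ?A = "\<lambda>g. \<integral>x. f x powr \<alpha> * g x powr (1 - \<alpha>) \<partial>M" and ?B = "\<lambda>g. \<integral>x. f x powr (1 - \<alpha>) * g x powr \<alpha> \<partial>M"
  \<comment> \<open>Both cross exponents give the same \<open>p * (p - 1)\<close>, which the factor
    \<open>- ?b\<close> turns into exactly 1; this is why the divergence is convex whatever the sign
    of \<open>\<alpha> * (1 - \<alpha>)\<close>.\<close>
  have "(1 - \<alpha>) * ((1 - \<alpha>) - 1) = - (\<alpha> * (1 - \<alpha>))" "\<alpha> * (\<alpha> - 1) = - (\<alpha> * (1 - \<alpha>))"
    by (simp_all add: algebra_simps)
  then have b: "0 \<le> - ?b * ((1 - \<alpha>) * ((1 - \<alpha>) - 1))" "0 \<le> - ?b * (\<alpha> * (\<alpha> - 1))"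
    using \<alpha> by (simp_all only:) simp_all
  have A: "- ?b * ?A c \<le> s * (- ?b * ?A g) + (1 - s) * (- ?b * ?A k)"
    unfolding c_def by (intro integral_powr_convex s b gk AE_I2) simp_all
  have B: "- ?b * ?B c \<le> s * (- ?b * ?B g) + (1 - s) * (- ?b * ?B k)"
    unfolding c_def by (intro integral_powr_convex s b gk AE_I2) simp_all
  have D: "sym_alpha_div M \<alpha> g f = ?b + ?b * total_mass M g + - ?b * ?A g + - ?b * ?B g"
    if "admissible g" for g
    unfolding sym_alpha_div_eq[OF that] total_mass_def right_diff_distrib distrib_left by simp
  have "sym_alpha_div M \<alpha> c f \<le> ?b + ?b * (s * total_mass M g + (1 - s) * total_mass M k)
      + (s * (- ?b * ?A g) + (1 - s) * (- ?b * ?A k)) + (s * (- ?b * ?B g) + (1 - s) * (- ?b * ?B k))"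
    unfolding D[OF c] T by (intro add_mono A B order_refl)
  also have "\<dots> = s * sym_alpha_div M \<alpha> g f + (1 - s) * sym_alpha_div M \<alpha> k f"
    unfolding D[OF g] D[OF k] by algebra
  finally show "sym_alpha_div M \<alpha> c f \<le> s * sym_alpha_div M \<alpha> g f + (1 - s) * sym_alpha_div M \<alpha> k f" .
qed

section \<open>Gateaux derivative of the Lagrangian and the pointwise stationarity equation\<close>

lemma perturbed:
  assumes g: "admissible g" and [measurable]: "\<psi> \<in> borel_measurable M"
    and c: "0 < c" "AE x in M. \<bar>\<psi> x\<bar> \<le> c * g x"
  shows admissible_perturbed: "\<bar>t\<bar> * c \<le> 1/2 \<Longrightarrow> admissible (\<lambda>x. g x + t * \<psi> x)"
    and integrable_L_deriv: "integrable M (\<lambda>x. L_deriv lam mu g x * \<psi> x)"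
    and has_derivative_L: "((\<lambda>t. L lam mu (\<lambda>x. g x + t * \<psi> x)) has_real_derivative
      (\<integral>x. L_deriv lam mu g x * \<psi> x \<partial>M)) (at 0)"
proof -
  note gD = admissibleD[OF g]
  note [measurable] = gD(1)
  interpret H: powr_functional M "\<lambda>x. h x powr u" g \<psi> "1 - u" c
    by unfold_locales (use gD c integrable_affinity[OF g] in simp_all)
  interpret A: powr_functional M "\<lambda>x. f x powr \<alpha>" g \<psi> "1 - \<alpha>" c
    by unfold_locales (use gD c in simp_all)
  interpret B: powr_functional M "\<lambda>x. f x powr (1 - \<alpha>)" g \<psi> \<alpha> c
    by unfold_locales (use gD c in simp_all)
  have \<psi>_int: "integrable M \<psi>"
  proof (rule Bochner_Integration.integrable_bound)
    show "integrable M (\<lambda>x. c * g x)" using gD(3) by simp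
    show "AE x in M. norm (\<psi> x) \<le> norm (c * g x)" using c(2) by eventually_elim simp
  qed measurable
  show adm: "admissible (\<lambda>x. g x + t * \<psi> x)" if t: "\<bar>t\<bar> * c \<le> 1/2" for t
  proof -
    have "AE x in M. 0 < g x + t * \<psi> x"
      using gD(2) c(2)
    proof eventually_elim
      case (elim x)
      have "\<bar>t * \<psi> x\<bar> \<le> \<bar>t\<bar> * (c * g x)"
        unfolding abs_mult using elim by (intro mult_left_mono) simp_all
      also have "\<dots> = (\<bar>t\<bar> * c) * g x" by (simp add: mult.assoc)
      also have "\<dots> \<le> 1/2 * g x" using elim t by (intro mult_right_mono) simp_all
      finally show ?case using elim by linarith
    qed
    then show ?thesis
      unfolding admissible_def
      using gD(3) \<psi>_int A.integrable_perturbed[OF t] B.integrable_perturbed[OF t] by simp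
  qed
  let ?b = "1 / (\<alpha> * (1 - \<alpha>))" and ?H = "\<lambda>t. \<integral>x. h x powr u * (g x + t * \<psi> x) powr (1 - u) \<partial>M"
  let ?A = "\<lambda>t. \<integral>x. f x powr \<alpha> * (g x + t * \<psi> x) powr (1 - \<alpha>) \<partial>M"
    and ?B = "\<lambda>t. \<integral>x. f x powr (1 - \<alpha>) * (g x + t * \<psi> x) powr \<alpha> \<partial>M"
    and ?T = "\<lambda>t. (\<integral>x. g x \<partial>M) + t * (\<integral>x. \<psi> x \<partial>M)"
  let ?H' = "\<lambda>x. h x powr u * ((1 - u) * g x powr (1 - u - 1) * \<psi> x)"
    and ?A' = "\<lambda>x. f x powr \<alpha> * ((1 - \<alpha>) * g x powr (1 - \<alpha> - 1) * \<psi> x)"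
    and ?B' = "\<lambda>x. f x powr (1 - \<alpha>) * (\<alpha> * g x powr (\<alpha> - 1) * \<psi> x)"
  note int' = H.integrable_derivative A.integrable_derivative B.integrable_derivative \<psi>_int
  have L_deriv: "(\<lambda>x. L_deriv lam mu g x * \<psi> x) =
      (\<lambda>x. ?H' x - lam * (?b * (\<psi> x - ?A' x - ?B' x)) - mu * \<psi> x)"
    unfolding L_deriv_def by (rule ext) (simp add: algebra_simps)
  show "integrable M (\<lambda>x. L_deriv lam mu g x * \<psi> x)"
    unfolding L_deriv
    by (intro Bochner_Integration.integrable_diff integrable_mult_right impI int')
  have "(\<integral>x. L_deriv lam mu g x * \<psi> x \<partial>M) = (\<integral>x. ?H' x \<partial>M)
      - lam * (?b * ((\<integral>x. \<psi> x \<partial>M) - (\<integral>x. ?A' x \<partial>M) - (\<integral>x. ?B' x \<partial>M))) - mu * (\<integral>x. \<psi> x \<partial>M)"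
    unfolding L_deriv
    by (simp only: Bochner_Integration.integral_diff Bochner_Integration.integrable_diff
        integrable_mult_right int' integral_mult_right_zero)
  moreover have "((\<lambda>t. ?H t + lam * (\<epsilon> - ?b * (1 + ?T t - ?A t - ?B t)) + mu * (1 - ?T t))
      has_real_derivative (\<integral>x. ?H' x \<partial>M)
      - lam * (?b * ((\<integral>x. \<psi> x \<partial>M) - (\<integral>x. ?A' x \<partial>M) - (\<integral>x. ?B' x \<partial>M))) - mu * (\<integral>x. \<psi> x \<partial>M)) (at 0)"
    by (rule derivative_eq_intros H.has_derivative_at_0 A.has_derivative_at_0
        B.has_derivative_at_0 refl)+ simp
  ultimately have "((\<lambda>t. ?H t + lam * (\<epsilon> - ?b * (1 + ?T t - ?A t - ?B t)) + mu * (1 - ?T t))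
      has_real_derivative (\<integral>x. L_deriv lam mu g x * \<psi> x \<partial>M)) (at 0)"
    by (simp only:)
  \<comment> \<open>The split formula for the divergence is available only for admissible
    perturbations, so the derivative is transferred on a neighborhood of 0 of radius
    \<open>1 / (2 * c)\<close>.\<close>
  then show "((\<lambda>t. L lam mu (\<lambda>x. g x + t * \<psi> x)) has_real_derivative
      (\<integral>x. L_deriv lam mu g x * \<psi> x \<partial>M)) (at 0)"
  proof (rule has_field_derivative_transform_within)
    show "0 < 1 / (2 * c)" using c(1) by simp
    fix t :: real assume "dist t 0 < 1 / (2 * c)"
    then have t: "\<bar>t\<bar> * c \<le> 1/2" using c(1) by (simp add: field_simps)
    have "(\<integral>x. g x + t * \<psi> x \<partial>M) = ?T t" using gD(3) \<psi>_int by simp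
    then show "?H t + lam * (\<epsilon> - ?b * (1 + ?T t - ?A t - ?B t)) + mu * (1 - ?T t) =
        L lam mu (\<lambda>x. g x + t * \<psi> x)"
      unfolding lagrangian_def u_affinity_def total_mass_def sym_alpha_div_eq[OF adm[OF t]]
      by (simp only:)
  qed simp
qed

lemma measurable_L_deriv [measurable]:
  assumes [measurable]: "g \<in> borel_measurable M"
  shows "L_deriv lam mu g \<in> borel_measurable M"
proof -
  have "L_deriv lam mu g = (\<lambda>x. L_deriv lam mu g x)" by simp
  then show ?thesis unfolding L_deriv_def by simp
qed

lemma stationary_iff:
  assumes g: "admissible g"
  shows "gateaux_stationary M (L lam mu) g \<longleftrightarrow> (AE x in M. L_deriv lam mu g x = 0)"
proof -
  note gD = admissibleD[OF g]
  note [measurable] = gD(1)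
  let ?E = "L_deriv lam mu g"
  show ?thesis
  proof
    assume stat: "gateaux_stationary M (L lam mu) g"
    \<comment> \<open>A permitted direction with \<open>c = 1\<close>, for which the derivative
      becomes the integral of \<open>g * \<bar>E\<bar>\<close>; its vanishing forces
      \<open>E = 0\<close> almost everywhere.\<close>
    let ?\<psi> = "\<lambda>x. g x * sgn (?E x)"
    have meas: "?\<psi> \<in> borel_measurable M" by measurable
    have bd: "AE x in M. \<bar>?\<psi> x\<bar> \<le> 1 * g x"
      using gD(2) by eventually_elim (simp add: abs_mult abs_sgn_eq)
    have "((\<lambda>t. L lam mu (\<lambda>x. g x + t * ?\<psi> x)) has_real_derivative 0) (at 0)"
      using stat[unfolded gateaux_stationary_def, THEN bspec, OF meas, THEN mp]
        exI[of "\<lambda>c. AE x in M. \<bar>?\<psi> x\<bar> \<le> c * g x", OF bd] by (simp only:)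
    then have "(\<integral>x. ?E x * ?\<psi> x \<partial>M) = 0"
      using has_derivative_L[OF g meas _ bd] by (blast intro: DERIV_unique zero_less_one)
    moreover have "AE x in M. 0 \<le> ?E x * ?\<psi> x"
      using gD(2)
      by eventually_elim (simp add: abs_sgn[symmetric] mult.left_commute[of "?E _"])
    ultimately have "AE x in M. ?E x * ?\<psi> x = 0"
      using integral_nonneg_eq_0_iff_AE[OF integrable_L_deriv[OF g meas _ bd]] by simp
    with gD(2) show "AE x in M. ?E x = 0"
      by eventually_elim (auto simp: sgn_zero_iff)
  next
    assume E: "AE x in M. ?E x = 0"
    show "gateaux_stationary M (L lam mu) g"
      unfolding gateaux_stationary_def
    proof (intro ballI impI)
      fix \<psi> assume \<psi>: "\<psi> \<in> borel_measurable M" and "\<exists>c. AE x in M. \<bar>\<psi> x\<bar> \<le> c * g x"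
      then obtain c where "0 < c" "AE x in M. \<bar>\<psi> x\<bar> \<le> c * g x"
        using relative_bound_pos gD(2) by blast
      from has_derivative_L[OF g \<psi> this, of lam mu]
      have "((\<lambda>t. L lam mu (\<lambda>x. g x + t * \<psi> x)) has_real_derivative (\<integral>x. ?E x * \<psi> x \<partial>M)) (at 0)"
        by simp
      moreover have "AE x in M. ?E x * \<psi> x = 0" using E by eventually_elim simp
      then have "(\<integral>x. ?E x * \<psi> x \<partial>M) = 0" by (rule integral_eq_zero_AE)
      ultimately show "((\<lambda>t. L lam mu (\<lambda>x. g x + t * \<psi> x)) has_real_derivative 0) (at 0)"
        by simp
    qed
  qed
qed

text \<open>In terms of the ratio \<open>r = g / f\<close>, the two divergence terms of the
  derivative are \<open>r powr (- \<alpha>)\<close> and \<open>r powr (\<alpha> - 1)\<close>. The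
  positive factor \<open>r powr \<alpha>\<close> makes the first constant and gives the second the
  exponent \<open>2 * \<alpha> - 1\<close>, without changing the zeros.\<close>

lemma L_deriv_mult_eq:
  assumes "0 < f x" "0 < g x" "0 < h x"
  shows "L_deriv lam mu g x * (g x / f x) powr \<alpha> =
    lam / (1 - \<alpha>) * (g x / f x) powr (2 * \<alpha> - 1)
      + ((1 - u) * (h x / g x) powr u - lam / (\<alpha> * (1 - \<alpha>)) - mu) * (g x / f x) powr \<alpha> + lam / \<alpha>"
proof -
  let ?r = "g x / f x"
  have r: "0 < ?r" using assms by simp
  have "f x powr \<alpha> * g x powr (- \<alpha>) * ?r powr \<alpha> = 1"
    using assms by (simp add: powr_divide powr_minus)
  moreover have "f x powr (1 - \<alpha>) * g x powr (\<alpha> - 1) = ?r powr (\<alpha> - 1)"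
    using assms by (simp add: powr_divide powr_diff)
  then have "f x powr (1 - \<alpha>) * g x powr (\<alpha> - 1) * ?r powr \<alpha> = ?r powr (2 * \<alpha> - 1)"
    by (simp add: powr_add[symmetric])
  moreover have "h x powr u * g x powr (- u) = (h x / g x) powr u"
    using assms by (simp add: powr_divide powr_minus_divide)
  moreover have "L_deriv lam mu g x * ?r powr \<alpha> =
      ((1 - u) * (h x powr u * g x powr (- u)) - lam / (\<alpha> * (1 - \<alpha>)) - mu) * ?r powr \<alpha>
      + lam / (\<alpha> * (1 - \<alpha>)) * (1 - \<alpha>) * (f x powr \<alpha> * g x powr (- \<alpha>) * ?r powr \<alpha>)
      + lam / (\<alpha> * (1 - \<alpha>)) * \<alpha> * (f x powr (1 - \<alpha>) * g x powr (\<alpha> - 1) * ?r powr \<alpha>)"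
    unfolding L_deriv_def by algebra
  moreover have "lam / (\<alpha> * (1 - \<alpha>)) * (1 - \<alpha>) = lam / \<alpha>" "lam / (\<alpha> * (1 - \<alpha>)) * \<alpha> = lam / (1 - \<alpha>)"
    using \<alpha> by simp_all
  ultimately show ?thesis by simp
qed

lemma kkt_iff_equation:
  "kkt M \<alpha> \<epsilon> f (\<lambda>g. u_affinity M u g h) lam mu g \<longleftrightarrow>
    multiplier_conditions M \<alpha> \<epsilon> f lam g \<and>
    (AE x in M. lam / (1 - \<alpha>) * (g x / f x) powr (2 * \<alpha> - 1)
      + ((1 - u) * (h x / g x) powr u - lam / (\<alpha> * (1 - \<alpha>)) - mu) * (g x / f x) powr \<alpha>
      + lam / \<alpha> = 0)"
proof (cases "admissible g")
  case True
  have "AE x in M. L_deriv lam mu g x = 0 \<longleftrightarrow> lam / (1 - \<alpha>) * (g x / f x) powr (2 * \<alpha> - 1)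
      + ((1 - u) * (h x / g x) powr u - lam / (\<alpha> * (1 - \<alpha>)) - mu) * (g x / f x) powr \<alpha>
      + lam / \<alpha> = 0"
    using f_pos h_pos admissibleD(2)[OF True]
  proof eventually_elim
    case (elim x)
    then show ?case
      unfolding L_deriv_mult_eq[of x g, OF elim(1,3,2), symmetric] by simp
  qed
  then have "(AE x in M. L_deriv lam mu g x = 0) \<longleftrightarrow>
      (AE x in M. lam / (1 - \<alpha>) * (g x / f x) powr (2 * \<alpha> - 1)
      + ((1 - u) * (h x / g x) powr u - lam / (\<alpha> * (1 - \<alpha>)) - mu) * (g x / f x) powr \<alpha>
      + lam / \<alpha> = 0)"
    by (rule eventually_subst)
  then show ?thesis unfolding kkt_def stationary_iff[OF True] by (simp only:)
next
  \<comment> \<open>Both sides contain feasibility, which implies admissibility, so both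
    fail.\<close>
  case False
  then show ?thesis unfolding kkt_def multiplier_conditions_def feasible_iff by blast
qed

section \<open>Equivalence of optimality and the KKT conditions\<close>

definition L_integrand :: "real \<Rightarrow> real \<Rightarrow> ('a \<Rightarrow> real) \<Rightarrow> 'a \<Rightarrow> real" where
  "L_integrand lam mu g x = h x powr u * g x powr (1 - u)
     - lam * (1 / (\<alpha> * (1 - \<alpha>)) * (f x + g x - f x powr \<alpha> * g x powr (1 - \<alpha>)
         - f x powr (1 - \<alpha>) * g x powr \<alpha>)) - mu * g x"

lemma L_integrand_tangent:
  assumes "0 \<le> lam" "0 < f x" "0 < g x" "0 < k x"
  shows "L_integrand lam mu k x \<le> L_integrand lam mu g x + L_deriv lam mu g x * (k x - g x)"
proof -
  let ?b = "1 / (\<alpha> * (1 - \<alpha>))"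
  have H: "(- (h x powr u)) * g x powr (1 - u) + (- (h x powr u)) * (1 - u) * g x powr (1 - u - 1) * (k x - g x)
      \<le> (- (h x powr u)) * k x powr (1 - u)"
    using assms u by (intro convex_mult_powr_tangent) (simp_all add: mult_le_0_iff zero_le_mult_iff)
  have ab: "(1 - \<alpha>) * ((1 - \<alpha>) - 1) = - (\<alpha> * (1 - \<alpha>))" "\<alpha> * (\<alpha> - 1) = - (\<alpha> * (1 - \<alpha>))"
    by (simp_all add: algebra_simps)
  \<comment> \<open>The products equal \<open>lam * w\<close>: here dual feasibility makes the
    pointwise Lagrangian concave.\<close>
  have s: "0 \<le> (- lam * ?b * w) * ((1 - \<alpha>) * ((1 - \<alpha>) - 1))" "0 \<le> (- lam * ?b * w) * (\<alpha> * (\<alpha> - 1))"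
    if "0 \<le> w" for w
    unfolding ab using that assms(1) \<alpha> by simp_all
  have A: "(- lam * ?b * f x powr \<alpha>) * g x powr (1 - \<alpha>)
      + (- lam * ?b * f x powr \<alpha>) * (1 - \<alpha>) * g x powr (1 - \<alpha> - 1) * (k x - g x)
      \<le> (- lam * ?b * f x powr \<alpha>) * k x powr (1 - \<alpha>)"
    using assms by (intro convex_mult_powr_tangent s) simp_all
  have B: "(- lam * ?b * f x powr (1 - \<alpha>)) * g x powr \<alpha>
      + (- lam * ?b * f x powr (1 - \<alpha>)) * \<alpha> * g x powr (\<alpha> - 1) * (k x - g x)
      \<le> (- lam * ?b * f x powr (1 - \<alpha>)) * k x powr \<alpha>"
    using assms by (intro convex_mult_powr_tangent s) simp_all
  have e: "1 - u - 1 = - u" "1 - \<alpha> - 1 = - \<alpha>" by simp_all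
  have "lam / (\<alpha> * (1 - \<alpha>)) = lam * ?b" by simp
  then show ?thesis
    using add_mono[OF H add_mono[OF A B]]
    unfolding L_integrand_def L_deriv_def e by (simp only: algebra_simps)
qed

lemma L_integrand_integral:
  assumes "admissible g"
  shows "integrable M (L_integrand lam mu g)"
    and "L lam mu g = (\<integral>x. L_integrand lam mu g x \<partial>M) + lam * \<epsilon> + mu"
proof -
  note gD = admissibleD[OF assms] integrable_affinity[OF assms]
  have I: "L_integrand lam mu g = (\<lambda>x. L_integrand lam mu g x)" by simp
  show "integrable M (L_integrand lam mu g)"
    by (subst I, unfold L_integrand_def, intro Bochner_Integration.integrable_diff Bochner_Integration.integrable_add
      integrable_mult_right impI gD f_int)
  have "(\<integral>x. L_integrand lam mu g x \<partial>M) = u_affinity M u g h - lam * sym_alpha_div M \<alpha> g f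
      - mu * total_mass M g"
    unfolding L_integrand_def sym_alpha_div_eq[OF assms] total_mass_def u_affinity_def
    by (simp only: Bochner_Integration.integral_diff Bochner_Integration.integral_add
        Bochner_Integration.integrable_diff Bochner_Integration.integrable_add
        integrable_mult_right gD f_int integral_mult_right_zero f_mass[unfolded total_mass_def])
  then show "L lam mu g = (\<integral>x. L_integrand lam mu g x \<partial>M) + lam * \<epsilon> + mu"
    unfolding lagrangian_def by (simp add: algebra_simps)
qed

lemma kkt_imp_arg_max:
  assumes "kkt M \<alpha> \<epsilon> f (\<lambda>g. u_affinity M u g h) lam mu g"
  shows "is_arg_max (\<lambda>g. u_affinity M u g h) (feasible M \<alpha> \<epsilon> f) g"
proof -
  have feas: "feasible M \<alpha> \<epsilon> f g" and lam: "0 \<le> lam" "lam * (\<epsilon> - sym_alpha_div M \<alpha> g f) = 0"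
    and stat: "gateaux_stationary M (L lam mu) g"
    using assms unfolding kkt_def multiplier_conditions_def by simp_all
  then have g: "admissible g" "total_mass M g = 1" unfolding feasible_iff by simp_all
  have "u_affinity M u k h \<le> u_affinity M u g h" if "feasible M \<alpha> \<epsilon> f k" for k
  proof -
    have k: "admissible k" "sym_alpha_div M \<alpha> k f \<le> \<epsilon>" "total_mass M k = 1"
      using that unfolding feasible_iff by simp_all
    have "(\<integral>x. L_integrand lam mu k x \<partial>M) \<le> (\<integral>x. L_integrand lam mu g x \<partial>M)"
    proof (rule integral_mono_AE)
      show "AE x in M. L_integrand lam mu k x \<le> L_integrand lam mu g x"
        using stat[unfolded stationary_iff[OF g(1)]] f_pos admissibleD(2)[OF g(1)] admissibleD(2)[OF k(1)]
      proof eventually_elim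
        case (elim x)
        then show ?case using L_integrand_tangent[of lam x g k mu] lam(1) by simp
      qed
    qed (intro L_integrand_integral g k)+
    then have "L lam mu k \<le> L lam mu g"
      unfolding L_integrand_integral(2)[OF g(1)] L_integrand_integral(2)[OF k(1)] by simp
    \<comment> \<open>Weak duality: the slack term is nonnegative at \<open>k\<close> and zero at
      \<open>g\<close>, and both mass terms vanish.\<close>
    moreover have "0 \<le> lam * (\<epsilon> - sym_alpha_div M \<alpha> k f)" using lam(1) k(2) by simp
    ultimately show ?thesis unfolding lagrangian_def lam(2) g(2) k(3) by simp
  qed
  with feas show ?thesis unfolding is_arg_max_def by (auto simp: not_less)
qed

text \<open>On multiples of \<open>f\<close> both cross terms are constant multiples of
  \<open>f\<close>. The values 1, 1/2 and 2 of \<open>c\<close> provide the points required by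
  \<open>convex_program_multipliers\<close>.\<close>

lemma scaled_nominal:
  assumes "0 < c"
  shows "admissible (\<lambda>x. c * f x)" "total_mass M (\<lambda>x. c * f x) = c"
proof -
  have [simp]: "integrable M f" by (rule f_int)
  have "AE x in M. f x powr \<alpha> * (c * f x) powr (1 - \<alpha>) = c powr (1 - \<alpha>) * f x"
    using f_pos by eventually_elim (use assms in \<open>simp add: powr_mult powr_diff\<close>)
  then have "integrable M (\<lambda>x. f x powr \<alpha> * (c * f x) powr (1 - \<alpha>)) \<longleftrightarrow>
      integrable M (\<lambda>x. c powr (1 - \<alpha>) * f x)"
    by (intro integrable_cong_AE) simp_all
  then have A: "integrable M (\<lambda>x. f x powr \<alpha> * (c * f x) powr (1 - \<alpha>))"
    using integrable_mult_right[of "c powr (1 - \<alpha>)" M f] by simp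
  have "AE x in M. f x powr (1 - \<alpha>) * (c * f x) powr \<alpha> = c powr \<alpha> * f x"
    using f_pos by eventually_elim (use assms in \<open>simp add: powr_mult powr_diff\<close>)
  then have "integrable M (\<lambda>x. f x powr (1 - \<alpha>) * (c * f x) powr \<alpha>) \<longleftrightarrow>
      integrable M (\<lambda>x. c powr \<alpha> * f x)"
    by (intro integrable_cong_AE) simp_all
  then have B: "integrable M (\<lambda>x. f x powr (1 - \<alpha>) * (c * f x) powr \<alpha>)"
    using integrable_mult_right[of "c powr \<alpha>" M f] by simp
  have "AE x in M. 0 < c * f x"
    using f_pos by eventually_elim (use assms in simp)
  with A B show "admissible (\<lambda>x. c * f x)" unfolding admissible_def by simp
  show "total_mass M (\<lambda>x. c * f x) = c" using f_mass unfolding total_mass_def by simp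
qed

text \<open>With the multipliers, \<open>g\<close> maximizes the Lagrangian over all admissible
  densities, constraints dropped. Hence the derivative vanishes also along directions that change
  the mass.\<close>

lemma arg_max_imp_kkt:
  assumes "is_arg_max (\<lambda>g. u_affinity M u g h) (feasible M \<alpha> \<epsilon> f) g"
  obtains lam mu where "kkt M \<alpha> \<epsilon> f (\<lambda>g. u_affinity M u g h) lam mu g"
proof -
  have feas: "feasible M \<alpha> \<epsilon> f g" using assms unfolding is_arg_max_def by simp
  then have g: "admissible g" "sym_alpha_div M \<alpha> g f \<le> \<epsilon>" "total_mass M g = 1"
    unfolding feasible_iff by simp_all
  have D_f: "sym_alpha_div M \<alpha> f f = 0"
    unfolding sym_alpha_div_def sym_alpha_integrand_def by simp
  obtain lam mu where lam: "0 \<le> lam" "lam * (\<epsilon> - sym_alpha_div M \<alpha> g f) = 0"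
    and L: "\<And>k. k \<in> Collect admissible \<Longrightarrow> u_affinity M u k h + lam * (\<epsilon> - sym_alpha_div M \<alpha> k f)
      + mu * (1 - total_mass M k) \<le> u_affinity M u g h"
  proof (rule convex_program_multipliers[of "Collect admissible" "\<lambda>g. u_affinity M u g h"
        "\<lambda>g. sym_alpha_div M \<alpha> g f" "total_mass M" g \<epsilon> 1 f "\<lambda>x. (1/2) * f x" "\<lambda>x. 2 * f x"])
    fix k k' :: "'a \<Rightarrow> real" and s :: real
    assume "k \<in> Collect admissible" "k' \<in> Collect admissible" "0 \<le> s" "s \<le> 1"
    then have "admissible k" "admissible k'" "0 \<le> s" "s \<le> 1" by simp_all
    note * = admissible_convex_combination[OF this] convexlike[OF this]
    show "\<exists>l\<in>Collect admissible.
        s * u_affinity M u k h + (1 - s) * u_affinity M u k' h \<le> u_affinity M u l h \<and>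
        sym_alpha_div M \<alpha> l f \<le> s * sym_alpha_div M \<alpha> k f + (1 - s) * sym_alpha_div M \<alpha> k' f \<and>
        total_mass M l = s * total_mass M k + (1 - s) * total_mass M k'"
      by (rule bexI[of _ "\<lambda>x. s * k x + (1 - s) * k' x"]) (use * in simp_all)
  next
    fix k assume "k \<in> Collect admissible" "sym_alpha_div M \<alpha> k f \<le> \<epsilon>" "total_mass M k = 1"
    then have "feasible M \<alpha> \<epsilon> f k" unfolding feasible_iff by simp
    then show "u_affinity M u k h \<le> u_affinity M u g h"
      using assms unfolding is_arg_max_def by (simp add: not_less)
  next
    show "f \<in> Collect admissible" using scaled_nominal(1)[of 1] by simp
    show "(\<lambda>x. (1/2) * f x) \<in> Collect admissible" "(\<lambda>x. 2 * f x) \<in> Collect admissible"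
      using scaled_nominal(1)[of "1/2"] scaled_nominal(1)[of 2] by simp_all
    show "total_mass M (\<lambda>x. (1/2) * f x) < 1" "1 < total_mass M (\<lambda>x. 2 * f x)"
      by (subst scaled_nominal(2); simp)+
  next
    fix lam mu
    assume "0 \<le> lam" "lam * (\<epsilon> - sym_alpha_div M \<alpha> g f) = 0"
      and "\<And>k. k \<in> Collect admissible \<Longrightarrow> u_affinity M u k h
        + lam * (\<epsilon> - sym_alpha_div M \<alpha> k f) + mu * (1 - total_mass M k) \<le> u_affinity M u g h"
    then show thesis by (rule that)
  qed (use g D_f \<epsilon> f_mass in \<open>simp_all\<close>)
  have max: "L lam mu k \<le> L lam mu g" if "admissible k" for k
    using L[of k] that unfolding lagrangian_def g(3) lam(2) by simp
  have "gateaux_stationary M (L lam mu) g"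
    unfolding gateaux_stationary_def
  proof (intro ballI impI)
    fix \<psi> assume \<psi>: "\<psi> \<in> borel_measurable M" and "\<exists>c. AE x in M. \<bar>\<psi> x\<bar> \<le> c * g x"
    then obtain c where c: "0 < c" "AE x in M. \<bar>\<psi> x\<bar> \<le> c * g x"
      using relative_bound_pos admissibleD(2)[OF g(1)] by blast
    have D: "((\<lambda>t. L lam mu (\<lambda>x. g x + t * \<psi> x)) has_real_derivative
        (\<integral>x. L_deriv lam mu g x * \<psi> x \<partial>M)) (at 0)"
      by (rule has_derivative_L[OF g(1) \<psi> c])
    have "(\<integral>x. L_deriv lam mu g x * \<psi> x \<partial>M) = 0"
    proof (rule DERIV_local_max[OF D])
      show "0 < 1 / (2 * c)" using c(1) by simp
      show "\<forall>t. \<bar>0 - t\<bar> < 1 / (2 * c) \<longrightarrow>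
          L lam mu (\<lambda>x. g x + t * \<psi> x) \<le> L lam mu (\<lambda>x. g x + 0 * \<psi> x)"
      proof (intro allI impI)
        fix t :: real assume "\<bar>0 - t\<bar> < 1 / (2 * c)"
        then have "\<bar>t\<bar> * c \<le> 1/2" using c(1) by (simp add: field_simps)
        from max[OF admissible_perturbed[OF g(1) \<psi> c this]]
        show "L lam mu (\<lambda>x. g x + t * \<psi> x) \<le> L lam mu (\<lambda>x. g x + 0 * \<psi> x)" by simp
      qed
    qed
    with D show "((\<lambda>t. L lam mu (\<lambda>x. g x + t * \<psi> x)) has_real_derivative 0) (at 0)" by simp
  qed
  then show thesis
    using that feas lam unfolding kkt_def multiplier_conditions_def by blast
qed

lemma arg_max_iff_kkt:
  "is_arg_max (\<lambda>g. u_affinity M u g h) (feasible M \<alpha> \<epsilon> f) g \<longleftrightarrow>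
    (\<exists>lam mu. kkt M \<alpha> \<epsilon> f (\<lambda>g. u_affinity M u g h) lam mu g)"
  using kkt_imp_arg_max arg_max_imp_kkt by metis

end

section \<open>The two coupled problems together\<close>

theorem mainTheorem5:
  fixes M :: "'a measure"
    and \<alpha> u \<epsilon>0 \<epsilon>1 :: real
    and f0 f1 g0 g1 :: "'a \<Rightarrow> real"
  assumes "\<alpha> \<noteq> 0" and "\<alpha> \<noteq> 1"
    and "0 < u" and "u < 1"
    and "0 < \<epsilon>0" and "0 < \<epsilon>1"
    and "f0 \<in> borel_measurable M" and "AE x in M. 0 < f0 x" and "total_mass M f0 = 1"
    and "f1 \<in> borel_measurable M" and "AE x in M. 0 < f1 x" and "total_mass M f1 = 1"
  shows
    "(least_favorable M \<alpha> u \<epsilon>0 \<epsilon>1 f0 f1 g0 g1 \<longleftrightarrow>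
       (\<exists>lam0 mu0 lam1 mu1.
          kkt M \<alpha> \<epsilon>0 f0 (\<lambda>g. u_affinity M u g g1) lam0 mu0 g0 \<and>
          kkt M \<alpha> \<epsilon>1 f1 (\<lambda>g. u_affinity M u g0 g) lam1 mu1 g1)) \<and>
     (\<forall>lam0 mu0 lam1 mu1.
        (kkt M \<alpha> \<epsilon>0 f0 (\<lambda>g. u_affinity M u g g1) lam0 mu0 g0 \<and>
         kkt M \<alpha> \<epsilon>1 f1 (\<lambda>g. u_affinity M u g0 g) lam1 mu1 g1) \<longleftrightarrow>
        (multiplier_conditions M \<alpha> \<epsilon>0 f0 lam0 g0 \<and>
         multiplier_conditions M \<alpha> \<epsilon>1 f1 lam1 g1 \<and>
         (AE x in M.
            lam0 / (1 - \<alpha>) * (g0 x / f0 x) powr (2 * \<alpha> - 1)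
            + ((1 - u) * (g1 x / g0 x) powr u - lam0 / (\<alpha> * (1 - \<alpha>)) - mu0)
                * (g0 x / f0 x) powr \<alpha>
            + lam0 / \<alpha> = 0) \<and>
         (AE x in M.
            lam1 / (1 - \<alpha>) * (g1 x / f1 x) powr (2 * \<alpha> - 1)
            + (u * (g1 x / g0 x) powr (u - 1) - lam1 / (\<alpha> * (1 - \<alpha>)) - mu1)
                * (g1 x / f1 x) powr \<alpha>
            + lam1 / \<alpha> = 0)))"
  (is "(?LF \<longleftrightarrow> (\<exists>lam0 mu0 lam1 mu1. ?K0 lam0 mu0 \<and> ?K1 lam1 mu1)) \<and> ?Eq")
proof (cases "feasible M \<alpha> \<epsilon>0 f0 g0 \<and> feasible M \<alpha> \<epsilon>1 f1 g1")
  \<comment> \<open>Feasibility of both densities is part of every condition compared, so all of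
    them fail. In the other case it supplies the positivity and integrability of the fixed density
    that the locale demands.\<close>
  case False
  then show ?thesis
    unfolding least_favorable_def is_arg_max_def kkt_def multiplier_conditions_def by blast
next
  case True
  have g: "g \<in> borel_measurable M \<and> (AE x in M. 0 < g x) \<and> integrable M g"
    if "feasible M \<alpha> \<epsilon> f g" for \<epsilon> f g
    using that unfolding feasible_def alpha_nbhd_def total_mass_def mem_Collect_eq
    by (metis not_integrable_integral_eq zero_neq_one)
  interpret P0: affinity_problem M \<alpha> u \<epsilon>0 f0 g1
    using assms True g by unfold_locales blast+
  interpret P1: affinity_problem M \<alpha> "1 - u" \<epsilon>1 f1 g0
    using assms True g by unfold_locales (blast | simp)+
  have J1: "u_affinity M (1 - u) g g0 = u_affinity M u g0 g" for g
    unfolding u_affinity_def by (simp add: mult.commute)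
  have K1: "?K1 lam mu \<longleftrightarrow> multiplier_conditions M \<alpha> \<epsilon>1 f1 lam g1 \<and>
      (AE x in M. lam / (1 - \<alpha>) * (g1 x / f1 x) powr (2 * \<alpha> - 1)
        + (u * (g1 x / g0 x) powr (u - 1) - lam / (\<alpha> * (1 - \<alpha>)) - mu) * (g1 x / f1 x) powr \<alpha>
        + lam / \<alpha> = 0)" for lam mu
  proof -
    \<comment> \<open>Exchanging the roles of the densities produces the reciprocal ratio with
      exponent \<open>1 - u\<close>; it is rewritten into the stated form where both are
      positive.\<close>
    have "AE x in M. (g0 x / g1 x) powr (1 - u) = (g1 x / g0 x) powr (u - 1)"
      using P0.h_pos P1.h_pos by eventually_elim (simp add: powr_divide powr_diff mult.commute)
    then have "(AE x in M. lam / (1 - \<alpha>) * (g1 x / f1 x) powr (2 * \<alpha> - 1)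
        + ((1 - (1 - u)) * (g0 x / g1 x) powr (1 - u) - lam / (\<alpha> * (1 - \<alpha>)) - mu) * (g1 x / f1 x) powr \<alpha>
        + lam / \<alpha> = 0) \<longleftrightarrow>
      (AE x in M. lam / (1 - \<alpha>) * (g1 x / f1 x) powr (2 * \<alpha> - 1)
        + (u * (g1 x / g0 x) powr (u - 1) - lam / (\<alpha> * (1 - \<alpha>)) - mu) * (g1 x / f1 x) powr \<alpha>
        + lam / \<alpha> = 0)"
      by (intro eventually_cong) (auto elim!: eventually_mono)
    then show ?thesis using P1.kkt_iff_equation[of lam mu g1] unfolding J1 by (simp only:)
  qed
  \<comment> \<open>Each pair of multipliers occurs in one problem only, so the joint existential
    splits.\<close>
  have "?LF \<longleftrightarrow> (\<exists>lam mu. ?K0 lam mu) \<and> (\<exists>lam mu. ?K1 lam mu)"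
    unfolding least_favorable_def P0.arg_max_iff_kkt P1.arg_max_iff_kkt[unfolded J1] ..
  moreover have ?Eq unfolding P0.kkt_iff_equation K1 by blast
  ultimately show ?thesis by blast
qed

end
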